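(* Let $X\in\mathbb{R}^{m\times n}$ with $\operatorname{rank}(X)=r\le d$, and let $0<p\le 1$, $p_1>0$, $p_2>0$ satisfy $1/p_1+1/p_2=1/p$. Then \[ \|X\|_{S_p}=\min_{X=UV^{T}}\|U\|_{S_{p_1}}\|V\|_{S_{p_2}} =\min_{X=UV^{T}}\left(\frac{p_2\|U\|_{S_{p_1}}^{p_1}+p_1\|V\|_{S_{p_2}}^{p_2}}{p_1+p_2}\right)^{1/p} =\min_{X=UV^{T}}\left(\frac{\|U\|_{S_{p_1}}^{p_1}/p_1+\|V\|_{S_{p_2}}^{p_2}/p_2}{1/p}\right)^{1/p}, \] where each minimum is over $U\in\mathbb{R}^{m\times d}$, $V\in\mathbb{R}^{n\times d}$ with $X=UV^{T}$, and each minimum is attained.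
   Context: For $0<q<\infty$ and a real matrix $Y$ with singular values $\sigma_1(Y),\dots,\sigma_k(Y)$ ($k$ the smaller dimension of $Y$), the Schatten-$q$ (quasi-)norm is $\|Y\|_{S_q}=\left(\sum_{i=1}^{k}\sigma_i(Y)^q\right)^{1/q}$. *)

theory Defs
  imports "Jordan_Normal_Form.DL_Rank" "Jordan_Normal_Form.Char_Poly"
begin

text \<open>The singular values of a real matrix Y (with n columns) are the square roots of the
  eigenvalues of the n x n matrix Y^T Y, counted with algebraic multiplicity.  Hence
  the q-th power sum of the singular values is the sum, over the roots of the
  characteristic polynomial of Y^T Y counted with multiplicity, of lambda powr (q/2).
  Zero eigenvalues (in particular the extra ones when n exceeds the smaller dimension)
  contribute 0 since q > 0 and 0 powr a = 0.\<close>

definition schatten_pow_sum :: "real mat \<Rightarrow> real \<Rightarrow> real" where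
  "schatten_pow_sum Y q =
     (let A = transpose_mat Y * Y
      in \<Sum>t\<in>{t. poly (char_poly A) t = 0}. real (order t (char_poly A)) * t powr (q / 2))"

definition schatten :: "real mat \<Rightarrow> real \<Rightarrow> real" where
  "schatten Y q = schatten_pow_sum Y q powr (1 / q)"

end

theory Submission
  imports Defs "Jordan_Normal_Form.Schur_Decomposition"
begin

text \<open>The heart of the matter is the Hoelder inequality for X = U V^T. Write the power sums
  of the singular values as tr |X|^p. For p \<le> 2, concavity gives
  tr |X|^p \<le> sum_j |X e_j|^p for every orthonormal basis e. Take for e the left singular vectors
  of V; then V^T e_j = t_j g_j, where the t_j are the singular values of V and the nonzero
  g_j are orthonormal, so |X e_j| = t_j |U g_j|. If p1 \<ge> 2, then convexity gives
  sum_j |U g_j|^p1 \<le> tr |U|^p1, and the scalar Hoelder inequality finishes this case; p2 \<ge> 2 is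
  symmetric. If p1 and p2 are both below 2, split U = E F by the polar decomposition with
  tr |E|^2 = tr |F|^r = tr |U|^p1 and 1/r = 1/p1 - 1/2, apply the first case to E and F V^T, and
  iterate on F V^T.

  The bounds by sums follow from the product bound by the weighted AM-GM inequality. Splitting
  the powers of the singular values of X between U and V in the ratio p/p1 : p/p2 makes the three power
  sums equal, which turns all inequalities into equalities.\<close>

subsection \<open>Scalar inequalities\<close>

text \<open>The tangent inequality for \<open>ln\<close> at the weighted geometric mean
  \<open>c\<close> reads \<open>1 + ln z - ln c \<le> z / c\<close>. The weighted average of its
  left sides at \<open>a\<close> and \<open>b\<close> is exactly \<open>1\<close>.\<close>

lemma weighted_am_gm:
  fixes a b s t :: real
  assumes "0 \<le> a" "0 \<le> b" "0 < s" "0 < t" "s + t = 1"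
  shows "a powr s * b powr t \<le> s * a + t * b"
proof (cases "a = 0 \<or> b = 0")
  case True
  then show ?thesis using assms by auto
next
  case False
  then have pos: "0 < a" "0 < b" using assms by auto
  define c where "c = a powr s * b powr t"
  have c: "0 < c" using pos by (simp add: c_def)
  have ln_c: "ln c = s * ln a + t * ln b"
    using pos by (simp add: c_def ln_mult ln_powr)
  have tangent: "1 + (ln z - ln c) \<le> z / c" if "0 < z" for z
    using exp_ge_add_one_self[of "ln z - ln c"] that c by (simp add: exp_diff)
  have "s * (1 + (ln a - ln c)) + t * (1 + (ln b - ln c)) =
      (s + t) * (1 - ln c) + (s * ln a + t * ln b)"
    by (simp add: algebra_simps)
  then have "1 = s * (1 + (ln a - ln c)) + t * (1 + (ln b - ln c))"
    using assms(5) ln_c by simp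
  also have "\<dots> \<le> s * (a / c) + t * (b / c)"
    using tangent pos assms by (intro add_mono mult_left_mono) auto
  also have "\<dots> = (s * a + t * b) / c"
    by (simp add: add_divide_distrib)
  finally show ?thesis using c by (simp add: c_def field_simps)
qed

text \<open>After both families are normalised to total one, the weighted AM-GM inequality applies
  term by term. The exponents \<open>s\<close> and \<open>t\<close> are the reciprocals of the usual
  conjugate pair.\<close>

lemma holder_sum_powr:
  fixes f g :: "'a \<Rightarrow> real"
  assumes "finite J" and f: "\<And>j. j \<in> J \<Longrightarrow> 0 \<le> f j" and g: "\<And>j. j \<in> J \<Longrightarrow> 0 \<le> g j"
    and st: "0 < s" "0 < t" "s + t = 1"
  shows "(\<Sum>j\<in>J. f j powr s * g j powr t) \<le> sum f J powr s * sum g J powr t"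
proof (cases "sum f J = 0 \<or> sum g J = 0")
  case True
  then have "\<forall>j\<in>J. f j powr s * g j powr t = 0"
    using assms(1) f g by (auto simp: sum_nonneg_eq_0_iff)
  then show ?thesis by simp
next
  case False
  define F G where "F = sum f J" and "G = sum g J"
  have pos: "0 < F" "0 < G"
    using False f g sum_nonneg[of J f] sum_nonneg[of J g] by (auto simp: F_def G_def)
  have "(\<Sum>j\<in>J. f j powr s * g j powr t) =
      F powr s * G powr t * (\<Sum>j\<in>J. (f j / F) powr s * (g j / G) powr t)"
    using pos f g by (simp add: sum_distrib_left powr_divide)
  also have "\<dots> \<le> F powr s * G powr t * (\<Sum>j\<in>J. s * (f j / F) + t * (g j / G))"
    using pos f g st by (intro mult_left_mono sum_mono weighted_am_gm) auto
  also have "(\<Sum>j\<in>J. s * (f j / F) + t * (g j / G)) = s * (F / F) + t * (G / G)"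
    by (simp only: F_def G_def sum.distrib sum_distrib_left sum_divide_distrib)
  finally show ?thesis using pos st by (simp add: F_def G_def)
qed

text \<open>Jensen for a concave power, obtained from Hoelder by writing each term as
  \<open>(w x)^s * w^(1 - s)\<close>. Weights of total at most one are allowed because contractions,
  and not only isometries, produce weights later.\<close>

lemma sum_powr_le_powr_sum:
  fixes w x :: "'a \<Rightarrow> real"
  assumes J: "finite J" and w: "\<And>j. j \<in> J \<Longrightarrow> 0 \<le> w j" and x: "\<And>j. j \<in> J \<Longrightarrow> 0 \<le> x j"
    and s: "0 < s" "s \<le> 1" and w1: "sum w J \<le> 1"
  shows "(\<Sum>j\<in>J. w j * x j powr s) \<le> (\<Sum>j\<in>J. w j * x j) powr s"
proof (cases "s = 1")
  case True
  have "(\<Sum>j\<in>J. w j * x j) \<ge> 0" using w x by (auto intro!: sum_nonneg)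
  then show ?thesis using True w x by auto
next
  case False
  have "(\<Sum>j\<in>J. w j * x j powr s) = (\<Sum>j\<in>J. (w j * x j) powr s * w j powr (1 - s))"
    using w x by (intro sum.cong)
      (auto simp: powr_mult powr_diff powr_add[symmetric] mult_ac split: if_splits)
  also have "\<dots> \<le> (\<Sum>j\<in>J. w j * x j) powr s * sum w J powr (1 - s)"
    using J w x s False by (intro holder_sum_powr) auto
  also have "\<dots> \<le> (\<Sum>j\<in>J. w j * x j) powr s * 1"
    using w w1 s by (intro mult_left_mono powr_le1) (auto simp: sum_nonneg)
  finally show ?thesis by simp
qed

text \<open>The convex case is the concave one with exponent \<open>1 / s\<close>, applied to the
  values \<open>x j powr s\<close>.\<close>

lemma powr_sum_le_sum_powr:
  fixes w x :: "'a \<Rightarrow> real"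
  assumes J: "finite J" and w: "\<And>j. j \<in> J \<Longrightarrow> 0 \<le> w j" and x: "\<And>j. j \<in> J \<Longrightarrow> 0 \<le> x j"
    and s: "1 \<le> s" and w1: "sum w J \<le> 1"
  shows "(\<Sum>j\<in>J. w j * x j) powr s \<le> (\<Sum>j\<in>J. w j * x j powr s)"
proof -
  have "(\<Sum>j\<in>J. w j * x j) = (\<Sum>j\<in>J. w j * (x j powr s) powr (1 / s))"
    using x s by (simp add: powr_powr)
  also have "\<dots> \<le> (\<Sum>j\<in>J. w j * x j powr s) powr (1 / s)"
    using assms by (intro sum_powr_le_powr_sum) auto
  finally have "(\<Sum>j\<in>J. w j * x j) powr s \<le> ((\<Sum>j\<in>J. w j * x j powr s) powr (1 / s)) powr s"
    using s w x by (intro powr_mono2 sum_nonneg) auto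
  also have "\<dots> = (\<Sum>j\<in>J. w j * x j powr s)"
    using s w x by (simp add: powr_powr sum_nonneg)
  finally show ?thesis .
qed

subsection \<open>Orthonormal bases\<close>

text \<open>Only the values below \<open>n\<close> matter. That \<open>n\<close> orthonormal vectors
  span the space is extracted from the square matrix \<open>cols_mat\<close>.\<close>

definition onb :: "nat \<Rightarrow> (nat \<Rightarrow> real vec) \<Rightarrow> bool" where
  "onb n w \<longleftrightarrow> (\<forall>i<n. w i \<in> carrier_vec n) \<and>
     (\<forall>i<n. \<forall>j<n. w i \<bullet> w j = (if i = j then 1 else 0))"

lemma onb_carrier: "onb n w \<Longrightarrow> i < n \<Longrightarrow> w i \<in> carrier_vec n"
  by (simp add: onb_def)

lemma onb_prod: "onb n w \<Longrightarrow> i < n \<Longrightarrow> j < n \<Longrightarrow> w i \<bullet> w j = (if i = j then 1 else 0)"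
  by (simp add: onb_def)

definition cols_mat :: "nat \<Rightarrow> (nat \<Rightarrow> real vec) \<Rightarrow> real mat" where
  "cols_mat n w = mat n n (\<lambda>(a, i). w i $ a)"

lemma cols_mat_carrier [simp]: "cols_mat n w \<in> carrier_mat n n"
  by (simp add: cols_mat_def)

lemma cols_mat_dim [simp]: "dim_row (cols_mat n w) = n" "dim_col (cols_mat n w) = n"
  by (simp_all add: cols_mat_def)

lemma col_cols_mat: "onb n w \<Longrightarrow> i < n \<Longrightarrow> col (cols_mat n w) i = w i"
  using onb_carrier[of n w i] by (auto simp: cols_mat_def)

text \<open>A one-sided inverse of a square matrix is two-sided; the second equation expresses the
  completeness of the orthonormal family.\<close>

lemma cols_mat_orthogonal:
  assumes "onb n w"
  shows "transpose_mat (cols_mat n w) * cols_mat n w = 1\<^sub>m n"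
    and "cols_mat n w * transpose_mat (cols_mat n w) = 1\<^sub>m n"
proof -
  let ?W = "cols_mat n w"
  have W: "?W \<in> carrier_mat n n" by simp
  show 1: "transpose_mat ?W * ?W = 1\<^sub>m n"
    using assms W by (intro eq_matI) (auto simp: col_cols_mat onb_prod)
  show "?W * transpose_mat ?W = 1\<^sub>m n"
    using mat_mult_left_right_inverse[OF _ W 1] W by simp
qed

text \<open>Completeness \<open>W W^T = 1\<close> is inserted in front of \<open>y\<close>, and one
  factor \<open>W\<close> is moved to \<open>x\<close>.\<close>

lemma onb_parseval:
  assumes w: "onb n w" and x: "x \<in> carrier_vec n" and y: "y \<in> carrier_vec n"
  shows "x \<bullet> y = (\<Sum>i<n. (w i \<bullet> x) * (w i \<bullet> y))"
proof -
  let ?W = "cols_mat n w"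
  have W: "?W \<in> carrier_mat n n" by simp
  have "y = ?W *\<^sub>v (transpose_mat ?W *\<^sub>v y)"
    using W y by (simp add: assoc_mult_mat_vec[symmetric, of _ n n _ n] cols_mat_orthogonal[OF w])
  then have "x \<bullet> y = x \<bullet> (?W *\<^sub>v (transpose_mat ?W *\<^sub>v y))" by simp
  also have "\<dots> = (transpose_mat ?W *\<^sub>v x) \<bullet> (transpose_mat ?W *\<^sub>v y)"
    using W x y by (intro transpose_vec_mult_scalar[symmetric, of _ n n] mult_mat_vec_carrier[of _ n n]) auto
  also have "\<dots> = (\<Sum>i<n. (w i \<bullet> x) * (w i \<bullet> y))"
    using W w by (auto simp: scalar_prod_def[of "_ *\<^sub>v _"] atLeast0LessThan col_cols_mat)
  finally show ?thesis .
qed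

lemma onb_vec_eqI:
  assumes w: "onb n w" and x: "x \<in> carrier_vec n" and y: "y \<in> carrier_vec n"
    and eq: "\<And>i. i < n \<Longrightarrow> w i \<bullet> x = w i \<bullet> y"
  shows "x = y"
proof (rule eq_vecI)
  fix a assume a: "a < dim_vec y"
  have "unit_vec n a \<bullet> x = unit_vec n a \<bullet> y"
    using onb_parseval[OF w _ x, of "unit_vec n a"] onb_parseval[OF w _ y, of "unit_vec n a"] eq
    by simp
  then show "x $ a = y $ a" using a x y by simp
qed (use x y in auto)

text \<open>Each row is determined by its coefficients in the basis. This reduces a polar
  factorization to a check on singular vectors.\<close>

lemma onb_mat_eqI:
  assumes w: "onb n w" and A: "A \<in> carrier_mat m n" and B: "B \<in> carrier_mat m n"
    and eq: "\<And>i. i < n \<Longrightarrow> A *\<^sub>v w i = B *\<^sub>v w i"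
  shows "A = B"
proof (rule eq_matI)
  fix a b assume a: "a < dim_row B" and b: "b < dim_col B"
  have "row A a = row B a"
  proof (rule onb_vec_eqI[OF w])
    fix i assume i: "i < n"
    have "row A a \<bullet> w i = row B a \<bullet> w i"
      using arg_cong[OF eq[OF i], of "\<lambda>v. v $ a"] a A B by simp
    then show "w i \<bullet> row A a = w i \<bullet> row B a"
      using A B a onb_carrier[OF w i] comm_scalar_prod[of _ n "w i"] by (metis row_carrier_vec carrier_matD(1))
  qed (use A B a in auto)
  then show "A $$ (a, b) = B $$ (a, b)"
    using a b A B by (metis carrier_matD index_row(1))
qed (use A B in auto)

lemma scalar_prod_mult_mat_vec:
  fixes A :: "'a::comm_semiring_0 mat"
  assumes "A \<in> carrier_mat m n" "x \<in> carrier_vec n" "y \<in> carrier_vec m"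
  shows "y \<bullet> (A *\<^sub>v x) = (transpose_mat A *\<^sub>v y) \<bullet> x"
  using transpose_vec_mult_scalar[OF assms] by simp

subsection \<open>Spectral theorem for real symmetric matrices\<close>

lemma scalar_prod_self_nonneg: "0 \<le> (v :: real vec) \<bullet> v"
  by (simp add: scalar_prod_def sum_nonneg)

lemma conjugate_real_vec [simp]: "conjugate (v :: real vec) = v"
  by (auto simp: conjugate_vec_def)

text \<open>Gram-Schmidt applied to a basis that starts with \<open>v\<close> keeps \<open>v\<close>
  in front; the resulting orthogonal vectors are then normalised.\<close>

lemma onb_extending:
  fixes v :: "real vec"
  assumes v: "v \<in> carrier_vec n" and v0: "v \<noteq> 0\<^sub>v n"
  obtains u c where "onb n u" "u 0 = c \<cdot>\<^sub>v v"
proof -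
  interpret cof_vec_space n "TYPE(real)" .
  define b where "b = basis_completion v"
  define ws where "ws = gram_schmidt n b"
  from basis_completion[OF v v0, folded b_def]
  have dist_b: "distinct b" and indep: "\<not> lin_dep (set b)" and b: "set b \<subseteq> carrier_vec n"
    and hdb: "hd b = v" and len_b: "length b = n" by auto
  from gram_schmidt_result[OF b dist_b indep refl, folded ws_def]
  have ws: "set ws \<subseteq> carrier_vec n" "corthogonal ws" "length ws = n"
    by (auto simp: len_b)
  have n: "0 < n" using v v0 by (cases n) auto
  then obtain vs where "b = v # vs" using hdb len_b by (cases b) auto
  then have "hd ws = v" using gram_schmidt_hd[OF v] by (simp add: ws_def)
  then have ws0: "ws ! 0 = v" using n ws(3) by (cases ws) auto
  have carr: "ws ! i \<in> carrier_vec n" if "i < n" for i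
    using that ws by auto
  have orth: "ws ! i \<bullet> ws ! j = 0 \<longleftrightarrow> i \<noteq> j" if "i < n" "j < n" for i j
    using corthogonalD[OF ws(2)] that ws(3) by simp
  define u where "u i = (1 / sqrt (ws ! i \<bullet> ws ! i)) \<cdot>\<^sub>v ws ! i" for i
  have "onb n u"
    unfolding onb_def
  proof (intro conjI allI impI)
    fix i j assume ij: "i < n" "j < n"
    have "u i \<bullet> u j = (ws ! i \<bullet> ws ! j) / (sqrt (ws ! i \<bullet> ws ! i) * sqrt (ws ! j \<bullet> ws ! j))"
      using carr[OF ij(1)] carr[OF ij(2)] by (simp add: u_def)
    also have "\<dots> = (if i = j then 1 else 0)"
      using orth[OF ij] scalar_prod_self_nonneg[of "ws ! i"] by auto
    finally show "u i \<bullet> u j = (if i = j then 1 else 0)" .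
  qed (use carr in \<open>simp add: u_def\<close>)
  then show thesis using that ws0 by (simp add: u_def)
qed

text \<open>Over the complex numbers an eigenvalue \<open>z\<close> exists. The form
  \<open>x* A x\<close> is real by symmetry and equals \<open>z |x|^2\<close>, so \<open>z\<close>
  is real; it is then a root of the real characteristic polynomial.\<close>

lemma symmetric_mat_eigenvector:
  fixes A :: "real mat"
  assumes A: "A \<in> carrier_mat n n" and sym: "transpose_mat A = A" and n: "0 < n"
  obtains v e where "v \<in> carrier_vec n" "v \<noteq> 0\<^sub>v n" "A *\<^sub>v v = e \<cdot>\<^sub>v v"
proof -
  let ?C = "map_mat complex_of_real A"
  have C: "?C \<in> carrier_mat n n" using A by simp
  from char_poly_factorized[OF C] obtain as
    where as: "char_poly ?C = (\<Prod>a\<leftarrow>as. [:- a, 1:])" "length as = n" by auto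
  then obtain z where "z \<in> set as" using n by (cases as) auto
  then have z: "poly (char_poly ?C) z = 0"
    by (auto simp: as poly_prod_list prod_list_zero_iff)
  then have "eigenvalue ?C z" using eigenvalue_root_char_poly[OF C] by simp
  then obtain x where x: "x \<in> carrier_vec n" "x \<noteq> 0\<^sub>v n" "?C *\<^sub>v x = z \<cdot>\<^sub>v x"
    using C by (auto simp: eigenvalue_def eigenvector_def)
  let ?S = "\<Sum>i<n. \<Sum>j<n. cnj (x $ i) * of_real (A $$ (i, j)) * x $ j"
  have "(\<Sum>i<n. cnj (x $ i) * (?C *\<^sub>v x) $ i) = ?S"
    using A x(1) by (intro sum.cong)
      (auto simp: scalar_prod_def atLeast0LessThan sum_distrib_left mult_ac)
  then have S: "z * (\<Sum>i<n. cnj (x $ i) * x $ i) = ?S"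
    using x by (simp add: sum_distrib_left mult_ac)
  have A_swap: "A $$ (i, j) = A $$ (j, i)" if "i < n" "j < n" for i j
    using that A arg_cong[OF sym, of "\<lambda>B. B $$ (i, j)"] by simp
  have "cnj ?S = (\<Sum>i<n. \<Sum>j<n. cnj (x $ j) * of_real (A $$ (j, i)) * x $ i)"
    using A_swap by (auto simp: mult_ac intro!: sum.cong)
  also have "\<dots> = ?S" by (rule sum.swap)
  finally have cnjS: "cnj ?S = ?S" .
  define N where "N = (\<Sum>i<n. (cmod (x $ i))\<^sup>2)"
  have N: "(\<Sum>i<n. cnj (x $ i) * x $ i) = of_real N"
    by (simp add: N_def complex_norm_square mult.commute del: of_real_power)
  obtain k where "k < n" "x $ k \<noteq> 0" using x(1,2) by force
  then have "0 < (cmod (x $ k))\<^sup>2" "k \<in> {..<n}" by auto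
  then have "N \<noteq> 0" unfolding N_def
    by (metis (no_types, lifting) finite_lessThan less_irrefl sum_nonneg_0 zero_le_power2)
  moreover have "cnj z * of_real N = z * of_real N"
    using cnjS S[symmetric] by (simp add: N)
  ultimately have "cnj z = z" by simp
  then obtain e where e: "z = complex_of_real e"
    by (metis Reals_cases complex_cnj_complex_of_real Reals_cnj_iff)
  have "poly (char_poly A) e = 0"
    using z by (simp add: e of_real_hom.char_poly_hom[OF A])
  then have "eigenvalue A e" using eigenvalue_root_char_poly[OF A] by simp
  then show thesis using that A by (auto simp: eigenvalue_def eigenvector_def)
qed

text \<open>Deflation by induction on the dimension: one eigenvector is split off, and an eigenbasis
  of the compression to its complement is carried back by the isometry \<open>U\<close>.\<close>

theorem symmetric_mat_spectral:
  fixes A :: "real mat"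
  assumes "A \<in> carrier_mat n n" "transpose_mat A = A"
  shows "\<exists>w l. onb n w \<and> (\<forall>i<n. A *\<^sub>v w i = l i \<cdot>\<^sub>v w i)"
  using assms
proof (induction n arbitrary: A)
  case 0
  then show ?case by (simp add: onb_def)
next
  case (Suc n)
  note A = Suc.prems(1) and sym = Suc.prems(2)
  obtain v e where v: "v \<in> carrier_vec (Suc n)" "v \<noteq> 0\<^sub>v (Suc n)" "A *\<^sub>v v = e \<cdot>\<^sub>v v"
    using symmetric_mat_eigenvector[OF A sym] by blast
  obtain u c where u: "onb (Suc n) u" and u0: "u 0 = c \<cdot>\<^sub>v v"
    using onb_extending[OF v(1,2)] by blast
  have uc: "u i \<in> carrier_vec (Suc n)" if "i < Suc n" for i
    using onb_carrier[OF u that] .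
  have Au0: "A *\<^sub>v u 0 = e \<cdot>\<^sub>v u 0"
    using A v by (simp add: u0 mult_mat_vec[OF A] smult_smult_assoc mult.commute)
  have symprod: "x \<bullet> (A *\<^sub>v y) = (A *\<^sub>v x) \<bullet> y"
    if "x \<in> carrier_vec (Suc n)" "y \<in> carrier_vec (Suc n)" for x y
    using scalar_prod_mult_mat_vec[OF A that(2,1)] sym by simp
  \<comment> \<open>the compression of A to the orthogonal complement of the eigenvector u 0\<close>
  define B where "B = mat n n (\<lambda>(i, j). u (Suc i) \<bullet> (A *\<^sub>v u (Suc j)))"
  have B: "B \<in> carrier_mat n n" by (simp add: B_def)
  have "transpose_mat B = B"
  proof (rule eq_matI)
    fix i j assume "i < dim_row B" "j < dim_col B"
    then have ij: "i < n" "j < n" using B by auto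
    then show "transpose_mat B $$ (i, j) = B $$ (i, j)"
      using symprod[of "u (Suc j)" "u (Suc i)"] comm_scalar_prod[of "A *\<^sub>v u (Suc j)" "Suc n" "u (Suc i)"] uc A
      by (simp add: B_def)
  qed (use B in auto)
  then obtain y l where y: "onb n y" and l: "\<And>i. i < n \<Longrightarrow> B *\<^sub>v y i = l i \<cdot>\<^sub>v y i"
    using Suc.IH[OF B] by blast
  define U where "U = mat (Suc n) n (\<lambda>(a, j). u (Suc j) $ a)"
  have U: "U \<in> carrier_mat (Suc n) n" by (simp add: U_def)
  have colU: "col U j = u (Suc j)" if "j < n" for j
    using that uc[of "Suc j"] by (auto simp: U_def)
  have Ut: "transpose_mat U *\<^sub>v x = vec n (\<lambda>j. u (Suc j) \<bullet> x)" for x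
    using U by (auto simp: colU)
  have UtU: "transpose_mat U * U = 1\<^sub>m n"
    using U u by (intro eq_matI) (auto simp: colU onb_prod)
  have UtAU: "transpose_mat U * (A * U) = B"
  proof (rule eq_matI)
    fix i j assume "i < dim_row B" "j < dim_col B"
    then have ij: "i < n" "j < n" using B by auto
    have "col (A * U) j = A *\<^sub>v u (Suc j)"
      using col_mult2[OF A U ij(2)] colU[OF ij(2)] by simp
    then show "(transpose_mat U * (A * U)) $$ (i, j) = B $$ (i, j)"
      using ij U A by (simp add: B_def colU)
  qed (use U A B in auto)
  have Utu0: "transpose_mat U *\<^sub>v u 0 = 0\<^sub>v n"
    using u by (auto simp: Ut onb_prod)
  define w where "w i = (case i of 0 \<Rightarrow> u 0 | Suc k \<Rightarrow> U *\<^sub>v y k)" for i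
  define l' where "l' i = (case i of 0 \<Rightarrow> e | Suc k \<Rightarrow> l k)" for i
  have yc: "y i \<in> carrier_vec n" if "i < n" for i using onb_carrier[OF y that] .
  have Uyc: "U *\<^sub>v y i \<in> carrier_vec (Suc n)" if "i < n" for i
    using mult_mat_vec_carrier[OF U yc[OF that]] .
  have u0_Uy: "u 0 \<bullet> (U *\<^sub>v y i) = 0" if "i < n" for i
    using scalar_prod_mult_mat_vec[OF U yc uc, of i 0] Utu0 that yc by simp
  have "onb (Suc n) w"
    unfolding onb_def
  proof (intro conjI allI impI)
    fix i assume "i < Suc n"
    then show "w i \<in> carrier_vec (Suc n)"
      using uc[of 0] Uyc by (cases i) (auto simp: w_def)
  next
    fix i j assume i: "i < Suc n" and j: "j < Suc n"
    have UyUy: "(U *\<^sub>v y a) \<bullet> (U *\<^sub>v y b) = y a \<bullet> y b" if "a < n" "b < n" for a b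
    proof -
      have "(U *\<^sub>v y a) \<bullet> (U *\<^sub>v y b) = (transpose_mat U *\<^sub>v (U *\<^sub>v y a)) \<bullet> y b"
        using scalar_prod_mult_mat_vec[OF U yc Uyc] that by simp
      also have "transpose_mat U *\<^sub>v (U *\<^sub>v y a) = y a"
        using U yc[OF that(1)] UtU by (simp add: assoc_mult_mat_vec[symmetric, of _ n "Suc n" _ n])
      finally show ?thesis .
    qed
    have Uy_u0: "(U *\<^sub>v y a) \<bullet> u 0 = 0" if "a < n" for a
      using u0_Uy[OF that] comm_scalar_prod[OF Uyc[OF that] uc[of 0]] by simp
    show "w i \<bullet> w j = (if i = j then 1 else 0)"
      using i j onb_prod[OF u, of 0 0] onb_prod[OF y] u0_Uy Uy_u0 UyUy
      by (cases i; cases j) (auto simp: w_def)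
  qed
  moreover have "A *\<^sub>v w i = l' i \<cdot>\<^sub>v w i" if i: "i < Suc n" for i
  proof (cases i)
    case 0
    then show ?thesis using Au0 by (simp add: w_def l'_def)
  next
    case (Suc k)
    then have k: "k < n" using i by simp
    have "A *\<^sub>v (U *\<^sub>v y k) = l k \<cdot>\<^sub>v (U *\<^sub>v y k)"
    \<comment> \<open>Both sides are tested against the basis \<open>u\<close>. Against
      \<open>u 0\<close> they vanish; against the other vectors the test amounts to
      \<open>U^T A U = B\<close> applied to the eigenvector \<open>y k\<close>.\<close>
    proof (rule onb_vec_eqI[OF u])
      fix j assume j: "j < Suc n"
      show "u j \<bullet> (A *\<^sub>v (U *\<^sub>v y k)) = u j \<bullet> (l k \<cdot>\<^sub>v (U *\<^sub>v y k))"
      proof (cases j)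
        case 0
        then show ?thesis
          using symprod[OF uc[of 0] Uyc[OF k]] Au0 u0_Uy[OF k] uc[of 0] Uyc[OF k] by simp
      next
        case (Suc h)
        then have h: "h < n" using j by simp
        have "transpose_mat U *\<^sub>v (A *\<^sub>v (U *\<^sub>v y k)) = (transpose_mat U * (A * U)) *\<^sub>v y k"
          using U A yc[OF k] by (simp add: assoc_mult_mat_vec[of _ n "Suc n" _ n] assoc_mult_mat_vec[of _ "Suc n" "Suc n" _ n])
        also have "\<dots> = l k \<cdot>\<^sub>v (transpose_mat U * U *\<^sub>v y k)"
          using l[OF k] yc[OF k] by (simp add: UtAU UtU)
        also have "\<dots> = transpose_mat U *\<^sub>v (l k \<cdot>\<^sub>v (U *\<^sub>v y k))"
          using U yc[OF k] Uyc[OF k]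
          by (simp add: assoc_mult_mat_vec[of _ n "Suc n" _ n] mult_mat_vec[of _ n "Suc n"])
        finally show ?thesis
          using h Suc by (auto simp: Ut dest!: arg_cong[of _ _ "\<lambda>v. v $ h"])
      qed
    qed (use A Uyc[OF k] in auto)
    then show ?thesis by (simp add: w_def l'_def Suc)
  qed
  ultimately show ?case by blast
qed

lemma mult_mat_vec_closed: "A \<in> carrier_mat m n \<Longrightarrow> A *\<^sub>v x \<in> carrier_vec m"
  by (intro carrier_vecI) auto

section \<open>Eigenvalue multiplicities through the characteristic polynomial\<close>

text \<open>An eigenbasis gives \<open>A = W D W^T\<close> with \<open>D\<close> diagonal, so
  \<open>A\<close> is similar to a triangular matrix whose characteristic polynomial can be read
  off.\<close>

lemma char_poly_onb:
  assumes A: "A \<in> carrier_mat n n" and w: "onb n w"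
    and ev: "\<And>i. i < n \<Longrightarrow> A *\<^sub>v w i = l i \<cdot>\<^sub>v w i"
  shows "char_poly A = (\<Prod>i<n. [:- l i, 1:])"
proof -
  let ?W = "cols_mat n w"
  have W: "?W \<in> carrier_mat n n" by simp
  define D where "D = mat n n (\<lambda>(i, j). if i = j then l i else 0)"
  have D: "D \<in> carrier_mat n n" by (simp add: D_def)
  have AW: "A * ?W = ?W * D"
  proof (rule eq_matI)
    fix a j assume "a < dim_row (?W * D)" "j < dim_col (?W * D)"
    then have a: "a < n" and j: "j < n" using D by auto
    have "(A * ?W) $$ (a, j) = (A *\<^sub>v w j) $ a"
      using A a j w by (simp add: col_cols_mat)
    also have "\<dots> = l j * w j $ a"
      using ev[OF j] onb_carrier[OF w j] a by simp
    also have "\<dots> = (\<Sum>b<n. w b $ a * (if b = j then l b else 0))"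
      using j by (simp add: if_distrib[of "(*) _"] mult.commute cong: if_cong)
    also have "\<dots> = (?W * D) $$ (a, j)"
      using a j by (auto simp: scalar_prod_def D_def cols_mat_def atLeast0LessThan)
    finally show "(A * ?W) $$ (a, j) = (?W * D) $$ (a, j)" .
  qed (use A D in auto)
  have "?W * D * transpose_mat ?W = A * (?W * transpose_mat ?W)"
    using assoc_mult_mat[OF A W, of "transpose_mat ?W" n] by (simp add: AW)
  then have eq: "A = ?W * D * transpose_mat ?W"
    using A by (simp add: cols_mat_orthogonal[OF w])
  have "{A, D, ?W, transpose_mat ?W} \<subseteq> carrier_mat n n" using A D by auto
  then have "similar_mat A D"
    using cols_mat_orthogonal(2,1)[OF w] eq by (rule similar_matI)
  then have "char_poly A = char_poly D" by (rule char_poly_similar)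
  also have "\<dots> = (\<Prod>a\<leftarrow>diag_mat D. [:- a, 1:])"
    using D by (intro char_poly_upper_triangular) (auto simp: upper_triangular_def D_def)
  also have "diag_mat D = map l [0..<n]"
    by (auto simp: diag_mat_def D_def)
  finally show ?thesis
    by (simp add: prod.distinct_set_conv_list[symmetric, of "[0..<n]", simplified] atLeast0LessThan o_def)
qed

lemma order_prod_linear:
  fixes l :: "nat \<Rightarrow> 'a::field"
  shows "order t (\<Prod>i<n. [:- l i, 1:]) = card {i. i < n \<and> l i = t}"
proof (induction n)
  case 0
  then show ?case by (simp add: order_0I)
next
  case (Suc n)
  have "(\<Prod>i<n. [:- l i, 1:]) \<noteq> 0" by simp
  then have "order t (\<Prod>i<Suc n. [:- l i, 1:]) = card {i. i < n \<and> l i = t} + (if l n = t then 1 else 0)"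
    using Suc by (auto simp: order_mult order_linear' simp del: mult_pCons_left mult_pCons_right)
  moreover have "{i. i < Suc n \<and> l i = t} = {i. i < n \<and> l i = t} \<union> (if l n = t then {n} else {})"
    by (auto simp: less_Suc_eq)
  ultimately show ?case by simp
qed

text \<open>Grouping the indices by the value of \<open>l\<close> turns algebraic multiplicities
  into repetitions in an enumerated list of eigenvalues.\<close>

lemma sum_roots_order:
  fixes l :: "nat \<Rightarrow> 'a::field" and f :: "'a \<Rightarrow> real" and n :: nat
  defines "c \<equiv> (\<Prod>i<n. [:- l i, 1:])"
  shows "(\<Sum>t\<in>{t. poly c t = 0}. real (order t c) * f t) = (\<Sum>i<n. f (l i))"
proof -
  have roots: "{t. poly c t = 0} = l ` {..<n}"
    by (auto simp: c_def poly_prod)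
  have "(\<Sum>i<n. f (l i)) = (\<Sum>t\<in>l ` {..<n}. \<Sum>i\<in>{i\<in>{..<n}. l i = t}. f (l i))"
    by (rule sum.image_gen) simp
  also have "\<dots> = (\<Sum>t\<in>l ` {..<n}. real (order t c) * f t)"
    by (intro sum.cong) (auto simp: c_def order_prod_linear)
  finally show ?thesis by (simp add: roots)
qed

subsection \<open>Singular bases\<close>

text \<open>The family w consists of right singular vectors of Y, and l lists the squares of the
  singular values.\<close>

definition sing_basis :: "real mat \<Rightarrow> (nat \<Rightarrow> real vec) \<Rightarrow> (nat \<Rightarrow> real) \<Rightarrow> bool" where
  "sing_basis Y w l \<longleftrightarrow> onb (dim_col Y) w \<and>
     (\<forall>i<dim_col Y. \<forall>j<dim_col Y. (Y *\<^sub>v w i) \<bullet> (Y *\<^sub>v w j) = (if i = j then l i else 0))"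

lemma sing_basis_onb: "sing_basis Y w l \<Longrightarrow> Y \<in> carrier_mat m n \<Longrightarrow> onb n w"
  unfolding sing_basis_def by (metis carrier_matD(2))

lemma sing_basis_prod:
  "sing_basis Y w l \<Longrightarrow> Y \<in> carrier_mat m n \<Longrightarrow> i < n \<Longrightarrow> j < n \<Longrightarrow>
    (Y *\<^sub>v w i) \<bullet> (Y *\<^sub>v w j) = (if i = j then l i else 0)"
  unfolding sing_basis_def by (metis carrier_matD(2))

lemma sing_basis_nonneg:
  "sing_basis Y w l \<Longrightarrow> Y \<in> carrier_mat m n \<Longrightarrow> i < n \<Longrightarrow> 0 \<le> l i"
  using sing_basis_prod[of Y w l m n i i] scalar_prod_self_nonneg[of "Y *\<^sub>v w i"] by simp

lemma scalar_prod_mult_mat_mult_mat: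
  fixes Y :: "real mat"
  assumes "Y \<in> carrier_mat m n" "x \<in> carrier_vec n" "y \<in> carrier_vec n"
  shows "(Y *\<^sub>v x) \<bullet> (Y *\<^sub>v y) = x \<bullet> (transpose_mat Y * Y *\<^sub>v y)"
proof -
  have "x \<bullet> (transpose_mat Y *\<^sub>v (Y *\<^sub>v y)) = (Y *\<^sub>v x) \<bullet> (Y *\<^sub>v y)"
    using scalar_prod_mult_mat_vec[of "transpose_mat Y" n m "Y *\<^sub>v y" x] assms by simp
  then show ?thesis using assms by (simp add: assoc_mult_mat_vec[of _ n m _ n])
qed

text \<open>Orthogonality of the images \<open>Y w_i\<close> says that \<open>Y^T Y\<close> is
  diagonal in the basis \<open>w\<close>; testing against each \<open>w j\<close> recovers the
  eigenvector equation.\<close>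

lemma sing_basis_eigen:
  assumes sb: "sing_basis Y w l" and Y: "Y \<in> carrier_mat m n" and i: "i < n"
  shows "transpose_mat Y * Y *\<^sub>v w i = l i \<cdot>\<^sub>v w i"
proof (rule onb_vec_eqI[OF sing_basis_onb[OF sb Y]])
  note w = sing_basis_onb[OF sb Y]
  fix j assume j: "j < n"
  have "w j \<bullet> (transpose_mat Y * Y *\<^sub>v w i) = (Y *\<^sub>v w j) \<bullet> (Y *\<^sub>v w i)"
    using scalar_prod_mult_mat_mult_mat[OF Y onb_carrier[OF w j] onb_carrier[OF w i]] by simp
  then show "w j \<bullet> (transpose_mat Y * Y *\<^sub>v w i) = w j \<bullet> (l i \<cdot>\<^sub>v w i)"
    using sing_basis_prod[OF sb Y j i] onb_prod[OF w j i] onb_carrier[OF w i] onb_carrier[OF w j] by simp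
qed (use Y onb_carrier[OF sing_basis_onb[OF sb Y] i] in auto)

lemma sing_basis_exists:
  obtains w l where "sing_basis Y w l"
proof -
  define m n where "m = dim_row Y" and "n = dim_col Y"
  have Y: "Y \<in> carrier_mat m n" by (auto simp: m_def n_def)
  have "transpose_mat (transpose_mat Y * Y) = transpose_mat Y * Y"
    using Y by (simp add: transpose_mult[of _ n m _ n])
  then obtain w l where w: "onb n w" and l: "\<And>i. i < n \<Longrightarrow> transpose_mat Y * Y *\<^sub>v w i = l i \<cdot>\<^sub>v w i"
    using symmetric_mat_spectral[of "transpose_mat Y * Y" n] Y by auto
  have "(Y *\<^sub>v w i) \<bullet> (Y *\<^sub>v w j) = (if i = j then l i else 0)" if "i < n" "j < n" for i j
    using that scalar_prod_mult_mat_mult_mat[OF Y onb_carrier[OF w] onb_carrier[OF w], of i j] onb_prod[OF w, of i j]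
      onb_carrier[OF w that(1)] onb_carrier[OF w that(2)] l[OF that(2)] by simp
  then have "sing_basis Y w l" using w by (simp add: sing_basis_def n_def)
  then show thesis by (rule that)
qed

text \<open>Bridge from the definition by characteristic polynomials to a sum over any singular
  basis, so the basis may be chosen to suit each estimate.\<close>

lemma schatten_pow_sum_sing_basis:
  assumes sb: "sing_basis Y w l" and Y: "Y \<in> carrier_mat m n"
  shows "schatten_pow_sum Y q = (\<Sum>i<n. l i powr (q / 2))"
proof -
  have "char_poly (transpose_mat Y * Y) = (\<Prod>i<n. [:- l i, 1:])"
    using sing_basis_eigen[OF sb Y] sing_basis_onb[OF sb Y] Y by (intro char_poly_onb) auto
  then show ?thesis
    by (simp add: schatten_pow_sum_def Let_def sum_roots_order[of _ _ "\<lambda>t. t powr (q / 2)"])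
qed

lemma schatten_pow_sum_nonneg: "0 \<le> schatten_pow_sum Y q"
  by (auto simp: schatten_pow_sum_def Let_def intro!: sum_nonneg)

lemma sing_basis_quadratic:
  assumes sb: "sing_basis Y w l" and Y: "Y \<in> carrier_mat m n" and x: "x \<in> carrier_vec n"
  shows "(Y *\<^sub>v x) \<bullet> (Y *\<^sub>v x) = (\<Sum>i<n. (w i \<bullet> x)\<^sup>2 * l i)"
proof -
  note w = sing_basis_onb[OF sb Y]
  have YYx: "transpose_mat Y * Y *\<^sub>v x \<in> carrier_vec n"
    using Y by (intro mult_mat_vec_closed) auto
  have "w i \<bullet> (transpose_mat Y * Y *\<^sub>v x) = l i * (w i \<bullet> x)" if i: "i < n" for i
  proof -
    have "w i \<bullet> (transpose_mat Y * Y *\<^sub>v x) = (transpose_mat Y * Y *\<^sub>v w i) \<bullet> x"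
      using scalar_prod_mult_mat_vec[of "transpose_mat Y * Y" n n x "w i"] Y x onb_carrier[OF w i]
      by (simp add: transpose_mult[of _ n m _ n])
    then show ?thesis using sing_basis_eigen[OF sb Y i] onb_carrier[OF w i] x by simp
  qed
  then show ?thesis
    unfolding scalar_prod_mult_mat_mult_mat[OF Y x x] onb_parseval[OF w x YYx]
    by (intro sum.cong) (auto simp: power2_eq_square)
qed

section \<open>Invariance of the power sums under transposition\<close>

lemma onb_norm:
  assumes "onb n w" "x \<in> carrier_vec n"
  shows "(\<Sum>i<n. (w i \<bullet> x)\<^sup>2) = x \<bullet> x"
  using onb_parseval[OF assms assms(2)] by (simp add: power2_eq_square)

text \<open>Double counting: the weights c i j, the squared coefficients of Y between the two singular
  bases, have row sums l i and column sums k j, and are supported where l i = k j.\<close>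

lemma schatten_pow_sum_transpose:
  assumes Y: "Y \<in> carrier_mat m n"
  shows "schatten_pow_sum (transpose_mat Y) q = schatten_pow_sum Y q"
proof -
  have Yt: "transpose_mat Y \<in> carrier_mat n m" using Y by simp
  obtain f l where fl: "sing_basis Y f l" by (rule sing_basis_exists)
  obtain e k where ek: "sing_basis (transpose_mat Y) e k" by (rule sing_basis_exists)
  note f = sing_basis_onb[OF fl Y] and e = sing_basis_onb[OF ek Yt]
  define s where "s = q / 2 - 1"
  define c where "c i j = (f i \<bullet> (transpose_mat Y *\<^sub>v e j))\<^sup>2" for i j
  have c': "c i j = (e j \<bullet> (Y *\<^sub>v f i))\<^sup>2" if "i < n" "j < m" for i j
    using scalar_prod_mult_mat_vec[OF Y onb_carrier[OF f] onb_carrier[OF e], of i j] that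
      comm_scalar_prod[OF onb_carrier[OF f that(1)] mult_mat_vec_closed[OF Yt, of "e j"]]
    by (simp add: c_def)
  have sum_i: "(\<Sum>i<n. c i j) = k j" if "j < m" for j
    using onb_norm[OF f, of "transpose_mat Y *\<^sub>v e j"] sing_basis_prod[OF ek Yt that that]
    by (simp add: c_def mult_mat_vec_closed[OF Yt])
  have sum_j: "(\<Sum>j<m. c i j) = l i" if "i < n" for i
    using onb_norm[OF e, of "Y *\<^sub>v f i"] sing_basis_prod[OF fl Y that that] that
    by (simp add: c' mult_mat_vec_closed[OF Y])
  \<comment> \<open>The identity \<open>Y^T (Y Y^T) = (Y^T Y) Y^T\<close> makes one pairing equal to
    both \<open>k j\<close> and \<open>l i\<close> times the coefficient whose square is
    \<open>c i j\<close>. Unless that coefficient vanishes, the two eigenvalues agree.\<close>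
  have supp: "l i = k j \<or> c i j = 0" if i: "i < n" and j: "j < m" for i j
  proof -
    note fi = onb_carrier[OF f i] and ej = onb_carrier[OF e j]
    have Ye: "transpose_mat Y *\<^sub>v e j \<in> carrier_vec n" by (rule mult_mat_vec_closed[OF Yt])
    have "k j * (f i \<bullet> (transpose_mat Y *\<^sub>v e j)) =
        f i \<bullet> (transpose_mat Y *\<^sub>v (transpose_mat (transpose_mat Y) * transpose_mat Y *\<^sub>v e j))"
      using sing_basis_eigen[OF ek Yt j] Yt ej fi Ye by (simp add: mult_mat_vec[OF Yt])
    also have "\<dots> = f i \<bullet> (transpose_mat Y * Y *\<^sub>v (transpose_mat Y *\<^sub>v e j))"
      using Y Ye ej by (simp add: assoc_mult_mat_vec[of _ n m _ n] assoc_mult_mat_vec[of _ m n _ m])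
    also have "\<dots> = (transpose_mat Y * Y *\<^sub>v f i) \<bullet> (transpose_mat Y *\<^sub>v e j)"
      using scalar_prod_mult_mat_vec[of "transpose_mat Y * Y" n n _ "f i"] Y Ye fi
      by (simp add: transpose_mult[of _ n m _ n])
    also have "\<dots> = l i * (f i \<bullet> (transpose_mat Y *\<^sub>v e j))"
      using sing_basis_eigen[OF fl Y i] fi Ye by simp
    finally show ?thesis by (auto simp: c_def)
  qed
  \<comment> \<open>Splitting off one factor \<open>x\<close> lets it be replaced by a row or column
    sum of \<open>c\<close>. At \<open>x = 0\<close> both sides are \<open>0\<close> for every real
    \<open>q\<close>, since \<open>0 powr a = 0\<close>.\<close>
  have split: "x powr (q / 2) = x powr s * x" if "0 \<le> x" for x :: real
    using that by (cases "x = 0") (auto simp: s_def powr_diff)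
  have "schatten_pow_sum (transpose_mat Y) q = (\<Sum>j<m. k j powr s * (\<Sum>i<n. c i j))"
    unfolding schatten_pow_sum_sing_basis[OF ek Yt]
    using sing_basis_nonneg[OF ek Yt] by (intro sum.cong) (auto simp: sum_i split)
  also have "\<dots> = (\<Sum>j<m. \<Sum>i<n. l i powr s * c i j)"
    unfolding sum_distrib_left
  proof (intro sum.cong refl)
    fix j i assume "j \<in> {..<m}" "i \<in> {..<n}"
    then show "k j powr s * c i j = l i powr s * c i j" using supp[of i j] by auto
  qed
  also have "\<dots> = (\<Sum>i<n. l i powr s * (\<Sum>j<m. c i j))"
    unfolding sum_distrib_left by (rule sum.swap)
  also have "\<dots> = schatten_pow_sum Y q"
    unfolding schatten_pow_sum_sing_basis[OF fl Y]
    using sing_basis_nonneg[OF fl Y] by (intro sum.cong) (auto simp: sum_j split)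
  finally show ?thesis .
qed

text \<open>With c i = l i powr s for the eigenvalues l of a matrix, this is its s-th power on the
  orthogonal complement of its kernel, since 0 powr s = 0 also for negative s.\<close>

definition spectral_mat :: "nat \<Rightarrow> (nat \<Rightarrow> real vec) \<Rightarrow> (nat \<Rightarrow> real) \<Rightarrow> real mat" where
  "spectral_mat n w c = mat n n (\<lambda>(a, b). \<Sum>i<n. c i * w i $ a * w i $ b)"

lemma spectral_mat_carrier [simp]: "spectral_mat n w c \<in> carrier_mat n n"
  by (simp add: spectral_mat_def)

lemma transpose_spectral_mat [simp]: "transpose_mat (spectral_mat n w c) = spectral_mat n w c"
  by (rule eq_matI) (auto simp: spectral_mat_def mult_ac)

lemma spectral_mat_mult_vec:
  assumes w: "onb n w" and j: "j < n"
  shows "spectral_mat n w c *\<^sub>v w j = c j \<cdot>\<^sub>v w j"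
proof (rule eq_vecI)
  note wc = onb_carrier[OF w]
  fix a assume "a < dim_vec (c j \<cdot>\<^sub>v w j)"
  then have a: "a < n" using wc[OF j] by simp
  have "(spectral_mat n w c *\<^sub>v w j) $ a = (\<Sum>b<n. (\<Sum>i<n. c i * w i $ a * w i $ b) * w j $ b)"
    using a wc[OF j] by (simp add: spectral_mat_def scalar_prod_def atLeast0LessThan)
  also have "\<dots> = (\<Sum>i<n. c i * w i $ a * (\<Sum>b<n. w i $ b * w j $ b))"
    by (simp add: sum_distrib_right sum_distrib_left mult_ac) (rule sum.swap)
  also have "\<dots> = (\<Sum>i<n. c i * w i $ a * (w i \<bullet> w j))"
    using wc[OF j] by (simp add: scalar_prod_def atLeast0LessThan)
  also have "\<dots> = (\<Sum>i<n. if i = j then c i * w i $ a else 0)"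
    using j by (intro sum.cong) (auto simp: onb_prod[OF w])
  also have "\<dots> = c j * w j $ a" using j by simp
  finally show "(spectral_mat n w c *\<^sub>v w j) $ a = (c j \<cdot>\<^sub>v w j) $ a"
    using a wc[OF j] by simp
qed (use onb_carrier[OF w j] in \<open>simp add: spectral_mat_def\<close>)

text \<open>The right factor acts diagonally on the right singular vectors of \<open>Y\<close>,
  which therefore remain singular vectors. Powers of \<open>l\<close> as the choice of
  \<open>c\<close> yield partial isometries and fractional-power factors.\<close>

lemma sing_basis_mult_spectral_mat:
  assumes sb: "sing_basis Y w l" and Y: "Y \<in> carrier_mat m n"
  shows "sing_basis (Y * spectral_mat n w c) w (\<lambda>i. (c i)\<^sup>2 * l i)"
    and "\<And>i. i < n \<Longrightarrow> Y * spectral_mat n w c *\<^sub>v w i = c i \<cdot>\<^sub>v (Y *\<^sub>v w i)"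
proof -
  note w = sing_basis_onb[OF sb Y]
  show *: "Y * spectral_mat n w c *\<^sub>v w i = c i \<cdot>\<^sub>v (Y *\<^sub>v w i)" if "i < n" for i
    using assoc_mult_mat_vec[OF Y spectral_mat_carrier onb_carrier[OF w that]]
      spectral_mat_mult_vec[OF w that] mult_mat_vec[OF Y onb_carrier[OF w that]] by simp
  have "dim_col (spectral_mat n w c) = n" by (simp add: spectral_mat_def)
  moreover have "Y *\<^sub>v w i \<in> carrier_vec m" for i by (rule mult_mat_vec_closed[OF Y])
  ultimately show "sing_basis (Y * spectral_mat n w c) w (\<lambda>i. (c i)\<^sup>2 * l i)"
    using w sing_basis_prod[OF sb Y] by (auto simp: sing_basis_def * power2_eq_square)
qed

lemma sing_basis_spectral_mat:
  assumes w: "onb n w"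
  shows "sing_basis (spectral_mat n w c) w (\<lambda>i. (c i)\<^sup>2)"
proof -
  have "(c i \<cdot>\<^sub>v w i) \<bullet> (c j \<cdot>\<^sub>v w j) = (if i = j then (c i)\<^sup>2 else 0)" if "i < n" "j < n" for i j
    using onb_carrier[OF w that(1)] onb_carrier[OF w that(2)] onb_prod[OF w that]
    by (simp add: power2_eq_square)
  then show ?thesis
    using w by (simp add: sing_basis_def spectral_mat_mult_vec carrier_matD[OF spectral_mat_carrier])
qed

subsection \<open>Hoelder inequality for the Schatten power sums\<close>

text \<open>The squared coefficients \<open>c i j\<close> between two orthonormal bases form a
  doubly stochastic matrix. One family of sums spreads each singular value over \<open>j\<close>;
  the other provides the weights for Jensen with the concave power \<open>q / 2\<close>.\<close>

lemma schatten_pow_sum_le_onb: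
  assumes X: "X \<in> carrier_mat m n" and e: "onb n e" and q: "0 < q" "q \<le> 2"
  shows "schatten_pow_sum X q \<le> (\<Sum>j<n. ((X *\<^sub>v e j) \<bullet> (X *\<^sub>v e j)) powr (q / 2))"
proof -
  obtain f l where fl: "sing_basis X f l" by (rule sing_basis_exists)
  note f = sing_basis_onb[OF fl X]
  define c where "c i j = (f i \<bullet> e j)\<^sup>2" for i j
  have sum_i: "(\<Sum>i<n. c i j) = 1" if "j < n" for j
    using onb_norm[OF f onb_carrier[OF e that]] onb_prod[OF e that that] by (simp add: c_def)
  have sum_j: "(\<Sum>j<n. c i j) = 1" if "i < n" for i
  proof -
    have "(\<Sum>j<n. c i j) = (\<Sum>j<n. (e j \<bullet> f i)\<^sup>2)"
      using comm_scalar_prod[OF onb_carrier[OF f that] onb_carrier[OF e]] by (simp add: c_def)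
    then show ?thesis
      using onb_norm[OF e onb_carrier[OF f that]] onb_prod[OF f that that] by simp
  qed
  have "schatten_pow_sum X q = (\<Sum>i<n. \<Sum>j<n. c i j * l i powr (q / 2))"
    unfolding schatten_pow_sum_sing_basis[OF fl X]
    by (intro sum.cong) (simp_all add: sum_distrib_right[symmetric] sum_j)
  also have "\<dots> = (\<Sum>j<n. \<Sum>i<n. c i j * l i powr (q / 2))"
    by (rule sum.swap)
  also have "\<dots> \<le> (\<Sum>j<n. (\<Sum>i<n. c i j * l i) powr (q / 2))"
    using q sing_basis_nonneg[OF fl X]
    by (intro sum_mono sum_powr_le_powr_sum) (auto simp: sum_i c_def[symmetric], simp add: c_def)
  also have "\<dots> = (\<Sum>j<n. ((X *\<^sub>v e j) \<bullet> (X *\<^sub>v e j)) powr (q / 2))"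
    by (simp add: sing_basis_quadratic[OF fl X onb_carrier[OF e]] c_def)
  finally show ?thesis .
qed

text \<open>For \<open>z = G^T u\<close>, expanding \<open>|u - G z|^2 \<ge> 0\<close> gives
  \<open>|u|^2 - 2 |z|^2 + |G z|^2\<close>. Since the squared singular values \<open>v j\<close> are
  at most one, \<open>|G z| \<le> |z|\<close>, and the bound follows.\<close>

lemma contraction_transpose:
  assumes sb: "sing_basis G e v" and G: "G \<in> carrier_mat m n"
    and v: "\<And>j. j < n \<Longrightarrow> v j \<le> 1" and u: "u \<in> carrier_vec m"
  shows "(transpose_mat G *\<^sub>v u) \<bullet> (transpose_mat G *\<^sub>v u) \<le> u \<bullet> u"
proof -
  note e = sing_basis_onb[OF sb G]
  define z where "z = transpose_mat G *\<^sub>v u"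
  have z: "z \<in> carrier_vec n" unfolding z_def by (rule mult_mat_vec_closed) (use G in auto)
  have Gz: "G *\<^sub>v z \<in> carrier_vec m" by (rule mult_mat_vec_closed[OF G])
  have "(G *\<^sub>v z) \<bullet> (G *\<^sub>v z) \<le> (\<Sum>j<n. (e j \<bullet> z)\<^sup>2 * 1)"
    unfolding sing_basis_quadratic[OF sb G z] using v by (intro sum_mono mult_left_mono) auto
  then have contr: "(G *\<^sub>v z) \<bullet> (G *\<^sub>v z) \<le> z \<bullet> z"
    using onb_norm[OF e z] by simp
  have uGz: "u \<bullet> (G *\<^sub>v z) = z \<bullet> z"
    using scalar_prod_mult_mat_vec[OF G z u] by (simp add: z_def)
  have "0 \<le> (u - G *\<^sub>v z) \<bullet> (u - G *\<^sub>v z)" by (rule scalar_prod_self_nonneg)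
  also have "\<dots> = u \<bullet> u - 2 * (u \<bullet> (G *\<^sub>v z)) + (G *\<^sub>v z) \<bullet> (G *\<^sub>v z)"
    using u Gz comm_scalar_prod[OF u Gz]
    by (simp add: minus_scalar_prod_distrib[of _ m] scalar_prod_minus_distrib[of _ m])
  finally show ?thesis using contr uGz by (simp add: z_def)
qed

text \<open>Here the weights \<open>c i j\<close> are doubly substochastic: one bound is the length
  of \<open>G e_j\<close>, the other the contraction property of \<open>G^T\<close>. Jensen is used
  for the convex power \<open>q / 2 \<ge> 1\<close>.\<close>

lemma sum_contraction_le_schatten_pow_sum:
  assumes U: "U \<in> carrier_mat m d" and G: "G \<in> carrier_mat d n"
    and sb: "sing_basis G e v" and v: "\<And>j. j < n \<Longrightarrow> v j \<le> 1" and q: "2 \<le> q"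
  shows "(\<Sum>j<n. ((U *\<^sub>v (G *\<^sub>v e j)) \<bullet> (U *\<^sub>v (G *\<^sub>v e j))) powr (q / 2)) \<le> schatten_pow_sum U q"
proof -
  obtain f l where fl: "sing_basis U f l" by (rule sing_basis_exists)
  note f = sing_basis_onb[OF fl U] and e = sing_basis_onb[OF sb G]
  have Ge: "G *\<^sub>v e j \<in> carrier_vec d" for j by (rule mult_mat_vec_closed[OF G])
  have Gt: "transpose_mat G \<in> carrier_mat n d" using G by simp
  define c where "c i j = (f i \<bullet> (G *\<^sub>v e j))\<^sup>2" for i j
  have c': "c i j = (e j \<bullet> (transpose_mat G *\<^sub>v f i))\<^sup>2" if "i < d" "j < n" for i j
    using scalar_prod_mult_mat_vec[OF G onb_carrier[OF e that(2)] onb_carrier[OF f that(1)]]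
      comm_scalar_prod[OF onb_carrier[OF e that(2)] mult_mat_vec_closed[OF Gt, of "f i"]]
    by (simp add: c_def)
  have sum_i: "(\<Sum>i<d. c i j) \<le> 1" if "j < n" for j
    using onb_norm[OF f Ge] sing_basis_prod[OF sb G that that] v[OF that] by (simp add: c_def)
  have sum_j: "(\<Sum>j<n. c i j) \<le> 1" if "i < d" for i
    using onb_norm[OF e mult_mat_vec_closed[OF Gt, of "f i"]]
      contraction_transpose[OF sb G v onb_carrier[OF f that]] onb_prod[OF f that that] that
    by (simp add: c')
  have "(\<Sum>j<n. ((U *\<^sub>v (G *\<^sub>v e j)) \<bullet> (U *\<^sub>v (G *\<^sub>v e j))) powr (q / 2)) =
      (\<Sum>j<n. (\<Sum>i<d. c i j * l i) powr (q / 2))"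
    by (simp add: sing_basis_quadratic[OF fl U Ge] c_def)
  also have "\<dots> \<le> (\<Sum>j<n. \<Sum>i<d. c i j * l i powr (q / 2))"
    using q sing_basis_nonneg[OF fl U] sum_i
    by (intro sum_mono powr_sum_le_sum_powr) (auto simp: c_def)
  also have "\<dots> = (\<Sum>i<d. (\<Sum>j<n. c i j) * l i powr (q / 2))"
    unfolding sum_distrib_right by (rule sum.swap)
  also have "\<dots> \<le> (\<Sum>i<d. 1 * l i powr (q / 2))"
    using sum_j by (intro sum_mono mult_right_mono) auto
  also have "\<dots> = schatten_pow_sum U q"
    by (simp add: schatten_pow_sum_sing_basis[OF fl U])
  finally show ?thesis .
qed

text \<open>The two ranges play opposite roles: \<open>p \<le> 2\<close> bounds the left side by
  concavity, and \<open>2 \<le> p1\<close> bounds the contribution of \<open>U\<close> by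
  convexity.\<close>

lemma schatten_holder_ge_2:
  assumes U: "U \<in> carrier_mat m d" and V: "V \<in> carrier_mat n d"
    and p: "0 < p" "p \<le> 2" and p1: "2 \<le> p1" and p2: "0 < p2" and hp: "1 / p1 + 1 / p2 = 1 / p"
  shows "schatten_pow_sum (U * transpose_mat V) p \<le>
      schatten_pow_sum U p1 powr (p / p1) * schatten_pow_sum V p2 powr (p / p2)"
proof -
  let ?X = "U * transpose_mat V"
  have X: "?X \<in> carrier_mat m n" and Vt: "transpose_mat V \<in> carrier_mat d n"
    using U V by auto
  obtain e k where ek: "sing_basis (transpose_mat V) e k" by (rule sing_basis_exists)
  note e = sing_basis_onb[OF ek Vt] and k = sing_basis_nonneg[OF ek Vt]
  \<comment> \<open>the partial isometry in the polar decomposition of the transpose of V\<close>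
  define G where "G = transpose_mat V * spectral_mat n e (\<lambda>j. k j powr (- 1 / 2))"
  have G: "G \<in> carrier_mat d n" using Vt by (simp add: G_def)
  have sb: "sing_basis G e (\<lambda>j. (k j powr (- 1 / 2))\<^sup>2 * k j)"
    and Ge: "\<And>j. j < n \<Longrightarrow> G *\<^sub>v e j = k j powr (- 1 / 2) \<cdot>\<^sub>v (transpose_mat V *\<^sub>v e j)"
    using sing_basis_mult_spectral_mat[OF ek Vt] by (simp_all add: G_def)
  \<comment> \<open>The images of the \<open>e j\<close> under \<open>G\<close> have length one
    where \<open>k j\<close> is nonzero, and vanish elsewhere because
    \<open>0 powr (- 1 / 2) = 0\<close>.\<close>
  have inv: "(k j powr (- 1 / 2))\<^sup>2 * k j = (if k j = 0 then 0 else 1)" if "j < n" for j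
  proof (cases "k j = 0")
    case False
    then have "0 < k j" using k[OF that] by simp
    then have "(k j powr (- 1 / 2))\<^sup>2 = k j powr (-1)"
      by (simp add: power2_eq_square powr_add[symmetric])
    then show ?thesis using \<open>0 < k j\<close> by (simp add: powr_minus)
  qed simp
  define c where "c j = (U *\<^sub>v (G *\<^sub>v e j)) \<bullet> (U *\<^sub>v (G *\<^sub>v e j))" for j
  have c0: "0 \<le> c j" for j by (simp add: c_def scalar_prod_self_nonneg)
  have Ve: "transpose_mat V *\<^sub>v e j \<in> carrier_vec d" for j by (rule mult_mat_vec_closed[OF Vt])
  have Xe: "(?X *\<^sub>v e j) \<bullet> (?X *\<^sub>v e j) = k j * c j" if "j < n" for j
  proof -
    have Xej: "?X *\<^sub>v e j = U *\<^sub>v (transpose_mat V *\<^sub>v e j)"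
      using assoc_mult_mat_vec[OF U Vt onb_carrier[OF e that]] .
    have UVe: "U *\<^sub>v (transpose_mat V *\<^sub>v e j) \<in> carrier_vec m" by (rule mult_mat_vec_closed[OF U])
    show ?thesis
    proof (cases "k j = 0")
      case True
      then have "transpose_mat V *\<^sub>v e j = 0\<^sub>v d"
        using sing_basis_prod[OF ek Vt that that] conjugate_square_eq_0_vec[OF Ve, of j] by simp
      then show ?thesis using True U Xej
        by (simp add: scalar_prod_def)
    next
      case False
      have "c j = (k j powr (- 1 / 2))\<^sup>2 * ((?X *\<^sub>v e j) \<bullet> (?X *\<^sub>v e j))"
        using UVe by (simp add: c_def Ge[OF that] mult_mat_vec[OF U Ve] Xej power2_eq_square)
      then show ?thesis using inv[OF that] False by (simp add: mult.assoc[symmetric] mult.commute)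
    qed
  qed
  have "schatten_pow_sum ?X p \<le> (\<Sum>j<n. (k j * c j) powr (p / 2))"
    using schatten_pow_sum_le_onb[OF X e p] by (simp add: Xe)
  \<comment> \<open>Both \<open>(p1 / 2) * (p / p1)\<close> and \<open>(p2 / 2) * (p / p2)\<close>
    equal \<open>p / 2\<close>, so scalar Hoelder with weights \<open>p / p1\<close> and
    \<open>p / p2\<close> produces the desired sums.\<close>
  also have "\<dots> = (\<Sum>j<n. (c j powr (p1 / 2)) powr (p / p1) * (k j powr (p2 / 2)) powr (p / p2))"
    using k c0 p1 p2 by (intro sum.cong) (auto simp: powr_mult powr_powr mult.commute)
  also have "\<dots> \<le> (\<Sum>j<n. c j powr (p1 / 2)) powr (p / p1) * (\<Sum>j<n. k j powr (p2 / 2)) powr (p / p2)"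
    using p p1 p2 hp by (intro holder_sum_powr) (auto simp: field_simps)
  also have "\<dots> \<le> schatten_pow_sum U p1 powr (p / p1) * (\<Sum>j<n. k j powr (p2 / 2)) powr (p / p2)"
    using sum_contraction_le_schatten_pow_sum[OF U G sb _ p1] inv p p1
    by (intro mult_right_mono powr_mono2) (auto simp: c_def intro!: sum_nonneg)
  also have "(\<Sum>j<n. k j powr (p2 / 2)) = schatten_pow_sum V p2"
    using schatten_pow_sum_sing_basis[OF ek Vt, of p2] schatten_pow_sum_transpose[OF V] by simp
  finally show ?thesis .
qed

text \<open>Induction on a bound for \<open>1 / p1\<close>: peeling off a factor with exponent two
  lowers this reciprocal by one half. \<open>V\<close> and \<open>p2\<close> stay fixed, while
  \<open>U\<close>, its number of rows \<open>m\<close>, \<open>p\<close> and \<open>p1\<close>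
  vary.\<close>

lemma schatten_holder_aux:
  assumes V: "V \<in> carrier_mat n d" and p2: "0 < p2"
    and U: "U \<in> carrier_mat m d"
    and p: "0 < p" "p \<le> 2" and p1: "0 < p1" and hp: "1 / p1 + 1 / p2 = 1 / p"
    and N: "1 / p1 \<le> (real N + 1) / 2"
  shows "schatten_pow_sum (U * transpose_mat V) p \<le>
      schatten_pow_sum U p1 powr (p / p1) * schatten_pow_sum V p2 powr (p / p2)"
  using U p p1 hp N
proof (induction N arbitrary: m U p p1)
  case 0
  then have "2 \<le> p1" by (simp add: field_simps)
  then show ?case using schatten_holder_ge_2[OF _ V] 0 p2 by blast
next
  case (Suc N)
  note U = Suc.prems(1) and p = Suc.prems(2,3) and p1 = Suc.prems(4) and hp = Suc.prems(5)
  consider "2 \<le> p1" | "2 \<le> p2" | "p1 < 2" "p2 < 2" by linarith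
  then show ?case
  proof cases
    case 1
    then show ?thesis using schatten_holder_ge_2[OF U V] p p2 hp by blast
  next
    case 2
    \<comment> \<open>Transposition exchanges the roles of \<open>U\<close> and \<open>V\<close>
      without changing the power sums.\<close>
    have "transpose_mat (U * transpose_mat V) = V * transpose_mat U"
      using transpose_mult[OF U, of "transpose_mat V" n] V by simp
    then have "schatten_pow_sum (U * transpose_mat V) p = schatten_pow_sum (V * transpose_mat U) p"
      using schatten_pow_sum_transpose[of "U * transpose_mat V" m n p] U V by simp
    also have "\<dots> \<le> schatten_pow_sum V p2 powr (p / p2) * schatten_pow_sum U p1 powr (p / p1)"
      using schatten_holder_ge_2[OF V U p 2 p1] hp by (simp add: add.commute)
    finally show ?thesis by (simp add: mult.commute)
  next
    case 3
    obtain w l where wl: "sing_basis U w l" by (rule sing_basis_exists)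
    note w = sing_basis_onb[OF wl U] and l = sing_basis_nonneg[OF wl U]
    \<comment> \<open>For a singular value sigma of \<open>U\<close>, the square root of
      \<open>l i\<close>, the factors \<open>E\<close> and \<open>F\<close> below receive
      \<open>sigma^a\<close> and \<open>sigma^(1 - a)\<close>. The choices of \<open>a\<close> and
      \<open>r\<close> make the square sum of \<open>E\<close> and the \<open>r\<close>-sum of
      \<open>F\<close> equal to the \<open>p1\<close>-sum of \<open>U\<close>.\<close>
    define a where "a = p1 / 2"
    have a: "0 < a" "a < 1" using p1 3 by (auto simp: a_def)
    define r where "r = p1 / (1 - a)"
    \<comment> \<open>This is the Hoelder exponent for the remaining product \<open>F V^T\<close>;
      together with exponent two for \<open>E\<close> it gives back \<open>p\<close>.\<close>
    define q where "q = 1 / (1 / r + 1 / p2)"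
    have r: "0 < r" "1 / r = 1 / p1 - 1 / 2" using a p1 by (auto simp: r_def a_def field_simps)
    have "0 < 1 / r + 1 / p2" by (intro add_pos_pos) (use r(1) p2 in auto)
    then have q: "0 < q" "1 / r + 1 / p2 = 1 / q" by (auto simp: q_def)
    \<comment> \<open>The case assumption on \<open>p2\<close> keeps \<open>q\<close> at most two,
      as the induction hypothesis demands.\<close>
    have "1 / 2 \<le> 1 / p2" using 3 p2 by (simp add: field_simps)
    also have "\<dots> \<le> 1 / q" using r q(2) by (metis add_increasing divide_nonneg_pos less_imp_le order_refl zero_le_one)
    finally have q2: "q \<le> 2" using q(1) by (simp add: field_simps)
    have hq: "1 / 2 + 1 / q = 1 / p" using r(2) q(2) hp by simp
    define E where "E = U * spectral_mat d w (\<lambda>i. l i powr ((a - 1) / 2))"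
    define F where "F = spectral_mat d w (\<lambda>i. l i powr ((1 - a) / 2))"
    have E: "E \<in> carrier_mat m d" and F: "F \<in> carrier_mat d d" using U by (auto simp: E_def F_def)
    have Ew: "E *\<^sub>v w i = l i powr ((a - 1) / 2) \<cdot>\<^sub>v (U *\<^sub>v w i)" if "i < d" for i
      using sing_basis_mult_spectral_mat(2)[OF wl U that] by (simp add: E_def)
    have EF: "U = E * F"
    proof (rule onb_mat_eqI[OF w U mult_carrier_mat[OF E F]])
      fix i assume i: "i < d"
      have Uw: "U *\<^sub>v w i \<in> carrier_vec m" by (rule mult_mat_vec_closed[OF U])
      have "E * F *\<^sub>v w i = l i powr ((1 - a) / 2) \<cdot>\<^sub>v (E *\<^sub>v w i)"
        using assoc_mult_mat_vec[OF E F onb_carrier[OF w i]] mult_mat_vec[OF E onb_carrier[OF w i]]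
        by (simp add: F_def spectral_mat_mult_vec[OF w i])
      also have "\<dots> = (l i powr ((1 - a) / 2) * l i powr ((a - 1) / 2)) \<cdot>\<^sub>v (U *\<^sub>v w i)"
        using Ew[OF i] by (simp add: smult_smult_assoc)
      also have "\<dots> = U *\<^sub>v w i"
      proof (cases "l i = 0")
        case True
        then have "U *\<^sub>v w i = 0\<^sub>v m"
          using sing_basis_prod[OF wl U i i] conjugate_square_eq_0_vec[OF Uw] by simp
        then show ?thesis by auto
      next
        case False
        then have "l i powr ((1 - a) / 2) * l i powr ((a - 1) / 2) = 1"
          using l[OF i] by (simp add: powr_add[symmetric] add_divide_distrib[symmetric])
        then show ?thesis by simp
      qed
      finally show "U *\<^sub>v w i = E * F *\<^sub>v w i" by simp
    qed
    have sE: "schatten_pow_sum E 2 = schatten_pow_sum U p1"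
    proof -
      have "(l i powr ((a - 1) / 2))\<^sup>2 * l i = l i powr (p1 / 2)" if "i < d" for i
        using l[OF that] by (cases "l i = 0")
          (auto simp: power2_eq_square powr_add[symmetric] a_def powr_mult_base mult.commute[of _ "l i"])
      then show ?thesis
        using sing_basis_mult_spectral_mat(1)[OF wl U, of "\<lambda>i. l i powr ((a - 1) / 2)"]
        using schatten_pow_sum_sing_basis[OF _ E, of w _ 2] schatten_pow_sum_sing_basis[OF wl U, of p1]
        by (simp add: E_def)
    qed
    have sF: "schatten_pow_sum F r = schatten_pow_sum U p1"
    proof -
      have "((l i powr ((1 - a) / 2))\<^sup>2) powr (r / 2) = l i powr (p1 / 2)" if "i < d" for i
      proof -
        have "(1 - a) * (r / 2) = p1 / 2" using a by (simp add: r_def field_simps)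
        then show ?thesis
          by (simp only: power2_eq_square powr_add[symmetric] powr_powr field_sum_of_halves)
      qed
      then show ?thesis
        using schatten_pow_sum_sing_basis[OF sing_basis_spectral_mat[OF w] spectral_mat_carrier, of _ r]
          schatten_pow_sum_sing_basis[OF wl U, of p1]
        by (simp add: F_def)
    qed
    \<comment> \<open>Since \<open>F\<close> is symmetric, \<open>F V^T\<close> is the transpose of
      \<open>Z\<close>, which brings \<open>U V^T\<close> into the form
      \<open>E Z^T\<close>.\<close>
    define Z where "Z = V * F"
    have Z: "Z \<in> carrier_mat n d" using V F by (simp add: Z_def)
    have Zt: "transpose_mat Z = F * transpose_mat V"
      using transpose_mult[OF V F] by (simp add: Z_def F_def)
    have "U * transpose_mat V = E * transpose_mat Z"
      using assoc_mult_mat[OF E F, of "transpose_mat V" n] V by (simp add: EF Zt)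
    then have "schatten_pow_sum (U * transpose_mat V) p \<le>
        schatten_pow_sum E 2 powr (p / 2) * schatten_pow_sum Z q powr (p / q)"
      using schatten_holder_ge_2[OF E Z p _ q(1) hq] by simp
    also have "schatten_pow_sum Z q = schatten_pow_sum (F * transpose_mat V) q"
      using schatten_pow_sum_transpose[OF Z, of q] by (simp add: Zt)
    also have "schatten_pow_sum E 2 powr (p / 2) * schatten_pow_sum (F * transpose_mat V) q powr (p / q) \<le>
        schatten_pow_sum E 2 powr (p / 2) *
          (schatten_pow_sum F r powr (q / r) * schatten_pow_sum V p2 powr (q / p2)) powr (p / q)"
      using Suc.IH[OF F q(1) q2 r(1) q(2)] r(2) Suc.prems(6) p q
      by (intro mult_left_mono powr_mono2) (auto simp: schatten_pow_sum_nonneg)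
    also have "\<dots> = schatten_pow_sum U p1 powr (p / 2 + p / r) * schatten_pow_sum V p2 powr (p / p2)"
      using q by (simp add: sE sF powr_mult powr_powr powr_add)
    also have "p / 2 + p / r = p * (1 / 2 + 1 / r)" by (simp add: algebra_simps)
    also have "\<dots> = p / p1" using r(2) by simp
    finally show ?thesis .
  qed
qed

theorem schatten_holder:
  assumes U: "U \<in> carrier_mat m d" and V: "V \<in> carrier_mat n d"
    and p: "0 < p" "p \<le> 2" and p1: "0 < p1" and p2: "0 < p2" and hp: "1 / p1 + 1 / p2 = 1 / p"
  shows "schatten_pow_sum (U * transpose_mat V) p \<le>
      schatten_pow_sum U p1 powr (p / p1) * schatten_pow_sum V p2 powr (p / p2)"
proof -
  obtain N where "2 / p1 \<le> real N" using real_arch_simple by blast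
  then have "1 / p1 \<le> (real N + 1) / 2" by simp
  then show ?thesis by (rule schatten_holder_aux[OF V p2 U p p1 hp])
qed

subsection \<open>Optimal factorizations\<close>

lemma mult_mat_unit_vec:
  fixes A :: "'a::semiring_1 mat"
  assumes "A \<in> carrier_mat m n" "j < n"
  shows "A *\<^sub>v unit_vec n j = col A j"
  using assms by (intro eq_vecI) auto

text \<open>The columns of \<open>X * B\<close> lie in the column space of \<open>X\<close> and are
  independent by injectivity. With right singular vectors as columns of \<open>B\<close>, this
  bounds the number of nonzero singular values by the rank.\<close>

lemma rank_ge_injective_mult:
  fixes X :: "'a::field mat"
  assumes X: "X \<in> carrier_mat m n" and B: "B \<in> carrier_mat n k"
    and inj: "\<And>v. v \<in> carrier_vec k \<Longrightarrow> X * B *\<^sub>v v = 0\<^sub>v m \<Longrightarrow> v = 0\<^sub>v k"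
  shows "k \<le> vec_space.rank m X"
proof -
  interpret vec_space "TYPE('a)" m .
  let ?M = "X * B" and ?C = "set (cols X)"
  have M: "?M \<in> carrier_mat m k" using X B by simp
  \<comment> \<open>The count uses the set of columns, so repetitions must be excluded: equal
    columns would put a difference of unit vectors into the kernel.\<close>
  have dist: "distinct (cols ?M)"
  proof (rule ccontr)
    assume "\<not> distinct (cols ?M)"
    then obtain i j where ij: "i < k" "j < k" "i \<noteq> j" "col ?M i = col ?M j"
      using M B unfolding distinct_conv_nth by auto
    have "?M *\<^sub>v (unit_vec k i - unit_vec k j) = ?M *\<^sub>v unit_vec k i - ?M *\<^sub>v unit_vec k j"
      by (rule mult_minus_distrib_mat_vec[OF M]) auto
    also have "\<dots> = 0\<^sub>v m"
      using ij M by (simp add: mult_mat_unit_vec[OF M])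
    finally have "unit_vec k i - unit_vec k j = (0\<^sub>v k :: 'a vec)"
      by (intro inj) auto
    then have "(unit_vec k i - unit_vec k j) $ i = (0\<^sub>v k :: 'a vec) $ i" by simp
    then show False using ij by simp
  qed
  have li: "\<not> lin_dep (set (cols ?M))"
    using lin_depE[OF M _ dist] inj by blast
  have C: "?C \<subseteq> carrier_vec m" using X cols_dim by blast
  have sub: "set (cols ?M) \<subseteq> span ?C"
  proof
    fix v assume "v \<in> set (cols ?M)"
    then obtain j where "j < k" "v = ?M *\<^sub>v unit_vec k j"
      using M B by (auto simp: in_set_conv_nth mult_mat_unit_vec[OF M])
    then have "v = X *\<^sub>v (B *\<^sub>v unit_vec k j)"
      using assoc_mult_mat_vec[OF X B] by simp
    moreover have "B *\<^sub>v unit_vec k j \<in> carrier_vec n" by (rule mult_mat_vec_closed[OF B])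
    ultimately show "v \<in> span ?C"
      using col_space_eq[OF X] mult_mat_vec_closed[OF X] X unfolding col_space_def by auto
  qed
  have subsp: "VectorSpace.subspace class_ring (span ?C) V" using C by (intro span_is_subspace) auto
  interpret W: vectorspace class_ring "vs (span ?C)"
    using subspace_is_vs[OF subsp] .
  have "card (set (cols ?M)) \<le> W.dim"
  proof (rule W.li_le_dim(2))
    show "W.fin_dim" using fin_dim_span_cols[OF X] .
    show "set (cols ?M) \<subseteq> carrier (vs (span ?C))" using sub by simp
    show "\<not> LinearCombinations.module.lin_dep class_ring (vs (span ?C)) (set (cols ?M))"
      using li span_li_not_depend(2)[OF sub] subsp by (simp add: VectorSpace.subspace_def)
  qed
  then show ?thesis
    using distinct_card[OF dist] M B by (simp add: rank_def)
qed

text \<open>A thin singular value decomposition padded with zero columns up to \<open>d\<close>. For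
  each positive singular value sigma, \<open>U\<close> and \<open>V\<close> get orthogonal columns
  of lengths \<open>sigma^(p / p1)\<close> and \<open>sigma^(p / p2)\<close>; the exponents add to
  one, and both power sums collect \<open>sigma^p\<close>.\<close>

theorem schatten_optimal_factorization:
  fixes X :: "real mat"
  assumes X: "X \<in> carrier_mat m n" and rank: "vec_space.rank m X \<le> d"
    and p: "0 < p" and p1: "0 < p1" and p2: "0 < p2" and hp: "1 / p1 + 1 / p2 = 1 / p"
  obtains U V where "U \<in> carrier_mat m d" "V \<in> carrier_mat n d" "X = U * transpose_mat V"
    "schatten_pow_sum U p1 = schatten_pow_sum X p" "schatten_pow_sum V p2 = schatten_pow_sum X p"
proof -
  obtain w l where wl: "sing_basis X w l" by (rule sing_basis_exists)
  note w = sing_basis_onb[OF wl X] and wc = onb_carrier[OF w] and l = sing_basis_nonneg[OF wl X]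
  have Xw: "X *\<^sub>v w i \<in> carrier_vec m" for i by (rule mult_mat_vec_closed[OF X])
  have Xw0: "X *\<^sub>v w i = 0\<^sub>v m" if "i < n" "l i = 0" for i
    using sing_basis_prod[OF wl X that(1,1)] that(2) conjugate_square_eq_0_vec[OF Xw, of i] by simp
  define J where "J = filter (\<lambda>i. l i \<noteq> 0) [0..<n]"
  define k where "k = length J"
  have J: "J ! j < n" "0 < l (J ! j)" if "j < k" for j
    using nth_mem[of j J] that l[of "J ! j"] by (auto simp: J_def k_def)
  have distJ: "distinct J" by (simp add: J_def)
  have J_eq: "J ! i = J ! j \<longleftrightarrow> i = j" if "i < k" "j < k" for i j
    using nth_eq_iff_index_eq[OF distJ] that by (simp add: k_def)
  have "k \<le> vec_space.rank m X"
  proof (rule rank_ge_injective_mult[OF X])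
    let ?B = "mat n k (\<lambda>(a, j). w (J ! j) $ a)"
    show B: "?B \<in> carrier_mat n k" by simp
    let ?M = "X * ?B"
    have M: "?M \<in> carrier_mat m k" using X B by simp
    have "col ?B j = w (J ! j)" if "j < k" for j
      using that wc[OF J(1)[OF that]] by auto
    then have col: "col ?M j = X *\<^sub>v w (J ! j)" if "j < k" for j
      using that col_mult2[OF X B] by simp
    fix v assume v: "v \<in> carrier_vec k" "?M *\<^sub>v v = 0\<^sub>v m"
    show "v = 0\<^sub>v k"
    proof (rule eq_vecI)
      fix i assume "i < dim_vec (0\<^sub>v k)"
      then have i: "i < k" by simp
      have "col ?M i \<in> carrier_vec m" by (rule carrier_vecI) (use X in simp)
      \<comment> \<open>The columns of \<open>?M\<close> are orthogonal with positive squared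
        lengths, so pairing \<open>?M v = 0\<close> with column \<open>i\<close> isolates the entry
        \<open>v $ i\<close>.\<close>
      then have "0 = col ?M i \<bullet> (?M *\<^sub>v v)" using v(2) by simp
      also have "\<dots> = (transpose_mat ?M *\<^sub>v col ?M i) \<bullet> v"
        using M v(1) i by (intro scalar_prod_mult_mat_vec) auto
      also have "\<dots> = (\<Sum>j<k. (transpose_mat ?M *\<^sub>v col ?M i) $ j * v $ j)"
        using v(1) by (simp add: scalar_prod_def[of _ v] atLeast0LessThan)
      also have "\<dots> = (\<Sum>j<k. (if j = i then l (J ! i) else 0) * v $ j)"
        using i M by (intro sum.cong) (auto simp: col sing_basis_prod[OF wl X J(1) J(1)] J_eq)
      also have "\<dots> = (\<Sum>j<k. if j = i then l (J ! i) * v $ j else 0)"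
        by (intro sum.cong) auto
      also have "\<dots> = l (J ! i) * v $ i" using i by simp
      finally show "v $ i = 0\<^sub>v k $ i" using J(2)[OF i] i by simp
    qed (use v in simp)
  qed
  then have kd: "k \<le> d" using rank by simp
  \<comment> \<open>Indices with zero singular value drop out; the others are renumbered along
    \<open>J\<close> and the sum is padded with zeros up to \<open>d\<close>.\<close>
  have reindex: "(\<Sum>i<n. f i) = (\<Sum>j<d. if j < k then f (J ! j) else 0)"
    if "\<And>i. i < n \<Longrightarrow> l i = 0 \<Longrightarrow> f i = 0" for f :: "nat \<Rightarrow> real"
  proof -
    have "(\<Sum>i<n. f i) = (\<Sum>i\<in>set J. f i)"
      using that by (intro sum.mono_neutral_right) (auto simp: J_def)
    also have "\<dots> = (\<Sum>j<k. f (J ! j))"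
      using bij_betw_nth[OF distJ, of "{..<k}" "set J"]
      by (intro sum.reindex_bij_betw[symmetric]) (auto simp: k_def)
    also have "\<dots> = (\<Sum>j<d. if j < k then f (J ! j) else 0)"
      using kd by (intro sum.mono_neutral_cong_left) auto
    finally show ?thesis .
  qed
  define s where "s j = l (J ! j)" for j
  \<comment> \<open>\<open>X w\<close> already has length \<open>sqrt (s j)\<close>, which accounts
    for the \<open>- 1\<close>; the division by two passes from squared singular values to singular
    values.\<close>
  define U where "U = mat m d (\<lambda>(a, j). if j < k then s j powr ((p / p1 - 1) / 2) * (X *\<^sub>v w (J ! j)) $ a else 0)"
  define V where "V = mat n d (\<lambda>(a, j). if j < k then s j powr (p / p2 / 2) * w (J ! j) $ a else 0)"
  have U: "U \<in> carrier_mat m d" and V: "V \<in> carrier_mat n d" by (simp_all add: U_def V_def)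
  have p12: "p / p1 + p / p2 = 1"
    using arg_cong[OF hp, of "\<lambda>x. p * x"] p by (simp add: algebra_simps)
  have colU: "col U j = (if j < k then s j powr ((p / p1 - 1) / 2) \<cdot>\<^sub>v (X *\<^sub>v w (J ! j)) else 0\<^sub>v m)"
    if "j < d" for j
    using that Xw[of "J ! j"] X by (auto simp: U_def)
  have colV: "col V j = (if j < k then s j powr (p / p2 / 2) \<cdot>\<^sub>v w (J ! j) else 0\<^sub>v n)"
    if "j < d" for j
    using that wc[OF J(1), of j] by (auto simp: V_def)
  have units: "onb d (unit_vec d)" by (auto simp: onb_def)
  \<comment> \<open>Because the columns are pairwise orthogonal, the unit vectors themselves are
    right singular vectors; padding columns contribute the value zero.\<close>
  have sU: "sing_basis U (unit_vec d) (\<lambda>j. if j < k then s j powr (p / p1) else 0)"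
  proof -
    have "col U i \<bullet> col U j = (if i = j then if j < k then s j powr (p / p1) else 0 else 0)"
      if "i < d" "j < d" for i j
    proof -
      have "s j powr ((p / p1 - 1) / 2) * (s j powr ((p / p1 - 1) / 2) * s j) = s j powr (p / p1)" if "j < k"
        using J(2)[OF that] by (simp add: mult.assoc[symmetric] powr_add[symmetric] powr_diff s_def)
      then show ?thesis
        using Xw[of "J ! i"] Xw[of "J ! j"] that sing_basis_prod[OF wl X J(1) J(1), of i j] J_eq[of i j]
        by (auto simp: colU s_def)
    qed
    then show ?thesis using U units by (simp add: sing_basis_def mult_mat_unit_vec[OF U])
  qed
  have sV: "sing_basis V (unit_vec d) (\<lambda>j. if j < k then s j powr (p / p2) else 0)"
  proof -
    have "col V i \<bullet> col V j = (if i = j then if j < k then s j powr (p / p2) else 0 else 0)"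
      if "i < d" "j < d" for i j
      using wc[OF J(1), of i] wc[OF J(1), of j] that onb_prod[OF w J(1) J(1), of i j] J_eq[of i j]
      by (auto simp: colV powr_add[symmetric])
    then show ?thesis using V units by (simp add: sing_basis_def mult_mat_unit_vec[OF V])
  qed
  have sum_X: "schatten_pow_sum X p = (\<Sum>j<d. if j < k then s j powr (p / 2) else 0)"
    unfolding schatten_pow_sum_sing_basis[OF wl X] s_def by (rule reindex) (use p in auto)
  have "schatten_pow_sum U p1 = schatten_pow_sum X p"
    unfolding schatten_pow_sum_sing_basis[OF sU U] sum_X
    using p1 by (intro sum.cong) (auto simp: powr_powr)
  moreover have "schatten_pow_sum V p2 = schatten_pow_sum X p"
    unfolding schatten_pow_sum_sing_basis[OF sV V] sum_X
    using p2 by (intro sum.cong) (auto simp: powr_powr)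
  moreover have "X = U * transpose_mat V"
  proof (rule eq_matI)
    fix a b assume "a < dim_row (U * transpose_mat V)" "b < dim_col (U * transpose_mat V)"
    then have a: "a < m" and b: "b < n" using U V by auto
    have Xwa: "w i \<bullet> row X a = (X *\<^sub>v w i) $ a" if "i < n" for i
      using a X comm_scalar_prod[OF wc[OF that], of "row X a"] by simp
    have "X $$ (a, b) = row X a \<bullet> unit_vec n b"
      using a b X by simp
    \<comment> \<open>Parseval in the basis \<open>w\<close> expands the entry as the usual sum of
      rank-one terms.\<close>
    also have "\<dots> = (\<Sum>i<n. (X *\<^sub>v w i) $ a * w i $ b)"
      using a b X wc Xwa by (subst onb_parseval[OF w]) auto
    also have "\<dots> = (\<Sum>j<d. if j < k then (X *\<^sub>v w (J ! j)) $ a * w (J ! j) $ b else 0)"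
      using Xw0 a by (intro reindex) simp
    also have "\<dots> = (\<Sum>j<d. U $$ (a, j) * V $$ (b, j))"
    proof (intro sum.cong refl)
      fix j assume "j \<in> {..<d}"
      moreover have "s j powr ((p / p1 - 1) / 2) * s j powr (p / p2 / 2) = 1" if "j < k"
      proof -
        have "p / p2 = 1 - p / p1" using p12 by simp
        then have "(p / p1 - 1) / 2 + p / p2 / 2 = 0"
          by (simp only:) (simp add: diff_divide_distrib)
        then show ?thesis
          using J(2)[OF that] by (simp only: powr_add[symmetric] s_def) simp
      qed
      ultimately show "(if j < k then (X *\<^sub>v w (J ! j)) $ a * w (J ! j) $ b else 0) = U $$ (a, j) * V $$ (b, j)"
        using a b by (simp add: U_def V_def)
    qed
    also have "\<dots> = (U * transpose_mat V) $$ (a, b)"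
      using a b U V by (simp add: scalar_prod_def atLeast0LessThan)
    finally show "X $$ (a, b) = (U * transpose_mat V) $$ (a, b)" .
  qed (use X U V in auto)
  ultimately show thesis using that U V by blast
qed

section \<open>The three minima\<close>

lemma schatten_powr: "q \<noteq> 0 \<Longrightarrow> schatten Y q powr q = schatten_pow_sum Y q"
  by (simp add: schatten_def powr_powr schatten_pow_sum_nonneg)

theorem theorem3:
  fixes X :: "real mat" and m n d r :: nat and p p1 p2 :: real
  assumes X: "X \<in> carrier_mat m n"
    and rk: "vec_space.rank m X = r" and rd: "r \<le> d"
    and p: "0 < p" "p \<le> 1" and p1: "0 < p1" and p2: "0 < p2"
    and hp: "1 / p1 + 1 / p2 = 1 / p"
  shows
    "(\<forall>U V. U \<in> carrier_mat m d \<longrightarrow> V \<in> carrier_mat n d \<longrightarrow> X = U * transpose_mat V \<longrightarrow>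
        schatten X p \<le> schatten U p1 * schatten V p2)
     \<and> (\<exists>U V. U \<in> carrier_mat m d \<and> V \<in> carrier_mat n d \<and> X = U * transpose_mat V \<and>
        schatten U p1 * schatten V p2 = schatten X p)
     \<and> (\<forall>U V. U \<in> carrier_mat m d \<longrightarrow> V \<in> carrier_mat n d \<longrightarrow> X = U * transpose_mat V \<longrightarrow>
        schatten X p \<le> ((p2 * schatten U p1 powr p1 + p1 * schatten V p2 powr p2) / (p1 + p2)) powr (1 / p))
     \<and> (\<exists>U V. U \<in> carrier_mat m d \<and> V \<in> carrier_mat n d \<and> X = U * transpose_mat V \<and>
        ((p2 * schatten U p1 powr p1 + p1 * schatten V p2 powr p2) / (p1 + p2)) powr (1 / p) = schatten X p)
     \<and> (\<forall>U V. U \<in> carrier_mat m d \<longrightarrow> V \<in> carrier_mat n d \<longrightarrow> X = U * transpose_mat V \<longrightarrow>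
        schatten X p \<le> ((schatten U p1 powr p1 / p1 + schatten V p2 powr p2 / p2) / (1 / p)) powr (1 / p))
     \<and> (\<exists>U V. U \<in> carrier_mat m d \<and> V \<in> carrier_mat n d \<and> X = U * transpose_mat V \<and>
        ((schatten U p1 powr p1 / p1 + schatten V p2 powr p2 / p2) / (1 / p)) powr (1 / p) = schatten X p)"
proof -
  have p_eq: "p = p1 * p2 / (p1 + p2)"
    using hp p p1 p2 by (simp add: field_simps)
  have p1_frac: "p / p1 = p2 / (p1 + p2)" and p2_frac: "p / p2 = p1 / (p1 + p2)"
    using p1 p2 by (simp_all add: p_eq)
  \<comment> \<open>Both averages in the statement are the same convex combination of the power
    sums, with weights \<open>p / p1\<close> and \<open>p / p2\<close>.\<close>
  have mean1: "(p2 * schatten U p1 powr p1 + p1 * schatten V p2 powr p2) / (p1 + p2) =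
      p / p1 * schatten_pow_sum U p1 + p / p2 * schatten_pow_sum V p2" for U V
    using p1 p2 by (simp add: schatten_powr p1_frac p2_frac add_divide_distrib)
  have mean2: "(schatten U p1 powr p1 / p1 + schatten V p2 powr p2 / p2) / (1 / p) =
      p / p1 * schatten_pow_sum U p1 + p / p2 * schatten_pow_sum V p2" for U V
    using p1 p2 by (simp add: schatten_powr algebra_simps)
  have frac: "0 < p / p1" "0 < p / p2" "p / p1 + p / p2 = 1"
    using p p1 p2 by (auto simp: p1_frac p2_frac add_divide_distrib[symmetric] add.commute)
  have product: "(schatten_pow_sum U p1 powr (p / p1) * schatten_pow_sum V p2 powr (p / p2)) powr (1 / p) =
      schatten U p1 * schatten V p2" for U V
    using p by (simp add: schatten_def powr_mult powr_powr)
  have lower: "schatten X p \<le> schatten U p1 * schatten V p2 \<and>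
      schatten X p \<le> (p / p1 * schatten_pow_sum U p1 + p / p2 * schatten_pow_sum V p2) powr (1 / p)"
    if "U \<in> carrier_mat m d" "V \<in> carrier_mat n d" "X = U * transpose_mat V" for U V
  proof -
    have *: "schatten_pow_sum X p \<le> schatten_pow_sum U p1 powr (p / p1) * schatten_pow_sum V p2 powr (p / p2)"
      using schatten_holder[OF that(1,2) _ _ p1 p2 hp] p that(3) by simp
    also have "\<dots> \<le> p / p1 * schatten_pow_sum U p1 + p / p2 * schatten_pow_sum V p2"
      using frac by (intro weighted_am_gm schatten_pow_sum_nonneg)
    finally have "schatten X p \<le> (p / p1 * schatten_pow_sum U p1 + p / p2 * schatten_pow_sum V p2) powr (1 / p)"
      using p by (auto simp: schatten_def intro!: powr_mono2 schatten_pow_sum_nonneg)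
    moreover have "schatten X p \<le>
        (schatten_pow_sum U p1 powr (p / p1) * schatten_pow_sum V p2 powr (p / p2)) powr (1 / p)"
      unfolding schatten_def[of X] using p * by (intro powr_mono2) (auto simp: schatten_pow_sum_nonneg)
    ultimately show ?thesis by (simp add: product)
  qed
  \<comment> \<open>One factorization attains all three minima, since its two power sums agree with
    that of \<open>X\<close> and the weights add to one.\<close>
  obtain U V where UV: "U \<in> carrier_mat m d" "V \<in> carrier_mat n d" "X = U * transpose_mat V"
    and sums: "schatten_pow_sum U p1 = schatten_pow_sum X p" "schatten_pow_sum V p2 = schatten_pow_sum X p"
    using schatten_optimal_factorization[OF X _ p(1) p1 p2 hp] rk rd by metis
  have "schatten U p1 * schatten V p2 = schatten X p"
    unfolding product[symmetric] sums using frac(3)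
    by (simp add: powr_add[symmetric] schatten_def schatten_pow_sum_nonneg)
  moreover have "(p / p1 * schatten_pow_sum U p1 + p / p2 * schatten_pow_sum V p2) powr (1 / p) = schatten X p"
    using frac(3) by (simp only: sums distrib_right[symmetric] schatten_def) simp
  ultimately show ?thesis
    unfolding mean1 mean2 using lower UV by blast
qed

end
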